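(* Let $p(x)=x^k-\sum_{i=1}^k\lambda_ix^{k-i}$. Then $p$ has a unique real root $\kappa>1$, which is its unique root of largest modulus, and for every nonnegative integer $s$, \[ \lim_{n\to\infty}\frac{L_{T,s}(n)}{n}=1-\frac{1}{\kappa}. \]
   Context: Fix nonnegative integers $\lambda_1,\lambda_2,\dots$ and an integer $k\ge1$ (the order) such that $\lambda_1\ge1$, $\lambda_k\ge1$, $\lambda_i=0$ for $i>k$, and $\lambda_1\ge2$ if $k=1$. Let $\Lambda_j=\sum_{i=1}^j\lambda_i$ and $\Lambda=\Lambda_k$. Trees are ordered. Finite trees $T_j$: $T_0$ is a single node; for $j\ge1$, $T_j$ has a chain of special nodes $s_j$ (root), $\dots,s_0$ with $s_i$ on level $i$ and $s_{i-1}$ the leftmost child of $s_i$, and $s_i$ ($1\le i\le j$) has $\Lambda_{j-i+1}$ children: $s_{i-1}$ followed by $\Lambda_{j-i+1}-1$ roots of copies of $T_{i-1}$. The skeleton $T$ is the infinite rootless tree with special nodes $u_0,u_1,\dots$, where $u_0$ is a leaf, $u_{i-1}$ is the leftmost child of $u_i$, and for $i\ge1$ the $i$-th supernode $u_i$ has, to the right of $u_{i-1}$, exactly $\Lambda-1$ further children, each the root of a copy of $T_{i-1}$. Labeling $T^{(s)}$: traverse $T$ by visiting $u_0$, then for $i=1,2,\dots$ visiting, in preorder (a node before its children, children left to right), the subtree consisting of $u_i$ together with its non-special children and all their descendants; a supernode $u_i$ ($i\ge1$) receives the $s$ smallest unused positive integers, and every other node (leaf or non-special internal node) receives the smallest unused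 positive integer. For $n\ge1$, $L_{T,s}(n)$ is the number of leaves of $T$ whose label is at most $n$. *)

theory Defs
  imports Complex_Main "HOL-Computational_Algebra.Polynomial"
begin

datatype otree = Node (subtrees: "otree list")

definition Lam :: "(nat \<Rightarrow> nat) \<Rightarrow> nat \<Rightarrow> nat" where
  "Lam lam j = (\<Sum>i=1..j. lam i)"

text \<open>For \<open>i \<le> j\<close>, \<open>chain lam j i\<close> is the subtree of \<open>T\<^sub>j\<close> rooted at its special node \<open>s\<^sub>i\<close>.
  The node \<open>s\<^sub>i\<^sub>+\<^sub>1\<close> has \<open>\<Lambda>\<^sub>j\<^sub>-\<^sub>i\<close> children, and \<open>chain lam i i\<close> is \<open>T\<^sub>i\<close>.\<close>

fun chain :: "(nat \<Rightarrow> nat) \<Rightarrow> nat \<Rightarrow> nat \<Rightarrow> otree" where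
  "chain lam j 0 = Node []"
| "chain lam j (Suc i) = Node (chain lam j i # replicate (Lam lam (j - i) - 1) (chain lam i i))"

definition fin_tree :: "(nat \<Rightarrow> nat) \<Rightarrow> nat \<Rightarrow> otree" where
  "fin_tree lam j = chain lam j j"

text \<open>A node of a finite tree is addressed by the list of child indices (from 0) leading to it
  from the root; \<open>preorder\<close> lists all these addresses in preorder.\<close>

primrec preorder :: "otree \<Rightarrow> nat list list" where
  "preorder (Node ts) =
     [] # concat (map2 (\<lambda>m ps. map ((#) m) ps) [0..<length ts] (map preorder ts))"

fun subtree_at :: "otree \<Rightarrow> nat list \<Rightarrow> otree" where
  "subtree_at t [] = t"
| "subtree_at t (m # p) = subtree_at (subtrees t ! m) p"

text \<open>\<open>branch lam k i\<close> consists of \<open>u\<^sub>i\<close> together with its non-special children and all their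
  descendants. A node of the skeleton is a pair \<open>(i, p)\<close> with \<open>p\<close> an address in the \<open>i\<close>-th branch;
  in particular \<open>u\<^sub>i = (i, [])\<close>. The child \<open>u\<^sub>i\<^sub>-\<^sub>1\<close> of \<open>u\<^sub>i\<close> is not part of the branch.\<close>

fun branch :: "(nat \<Rightarrow> nat) \<Rightarrow> nat \<Rightarrow> nat \<Rightarrow> otree" where
  "branch lam k 0 = Node []"
| "branch lam k (Suc i) = Node (replicate (Lam lam k - 1) (fin_tree lam i))"

type_synonym node = "nat \<times> nat list"

definition skel_nodes :: "(nat \<Rightarrow> nat) \<Rightarrow> nat \<Rightarrow> node set" where
  "skel_nodes lam k = {(i, p). p \<in> set (preorder (branch lam k i))}"

definition is_supernode :: "node \<Rightarrow> bool" where
  "is_supernode v \<longleftrightarrow> fst v \<ge> 1 \<and> snd v = []"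

fun skel_children :: "(nat \<Rightarrow> nat) \<Rightarrow> nat \<Rightarrow> node \<Rightarrow> node list" where
  "skel_children lam k (i, p) =
     (if is_supernode (i, p) then [(i - 1, [])] else []) @
     map (\<lambda>m. (i, p @ [m])) [0..<length (subtrees (subtree_at (branch lam k i) p))]"

definition skel_leaves :: "(nat \<Rightarrow> nat) \<Rightarrow> nat \<Rightarrow> node set" where
  "skel_leaves lam k = {v \<in> skel_nodes lam k. skel_children lam k v = []}"

definition branch_order :: "(nat \<Rightarrow> nat) \<Rightarrow> nat \<Rightarrow> nat \<Rightarrow> node list" where
  "branch_order lam k i = map (Pair i) (preorder (branch lam k i))"

text \<open>\<open>visit lam k t\<close> is the node visited at time \<open>t = 0, 1, \<dots>\<close>. Every branch has at least one
  node, so the first \<open>t + 1\<close> branches contain it.\<close>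

definition visit :: "(nat \<Rightarrow> nat) \<Rightarrow> nat \<Rightarrow> nat \<Rightarrow> node" where
  "visit lam k t = concat (map (branch_order lam k) [0..<Suc t]) ! t"

text \<open>\<open>smallest_unused m A\<close> is the set of the \<open>m\<close> smallest positive integers outside \<open>A\<close>.\<close>

fun smallest_unused :: "nat \<Rightarrow> nat set \<Rightarrow> nat set" where
  "smallest_unused 0 A = {}"
| "smallest_unused (Suc m) A =
     (let x = (LEAST x. x \<ge> 1 \<and> x \<notin> A) in insert x (smallest_unused m (insert x A)))"

definition label_count :: "nat \<Rightarrow> node \<Rightarrow> nat" where
  "label_count s v = (if is_supernode v then s else 1)"

fun used_labels :: "(nat \<Rightarrow> nat) \<Rightarrow> nat \<Rightarrow> nat \<Rightarrow> nat \<Rightarrow> nat set" where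
  "used_labels lam k s 0 = {}"
| "used_labels lam k s (Suc t) = used_labels lam k s t \<union>
     smallest_unused (label_count s (visit lam k t)) (used_labels lam k s t)"

definition labels :: "(nat \<Rightarrow> nat) \<Rightarrow> nat \<Rightarrow> nat \<Rightarrow> node \<Rightarrow> nat set" where
  "labels lam k s v =
     (\<Union>t\<in>{t. visit lam k t = v}. smallest_unused (label_count s v) (used_labels lam k s t))"

text \<open>A leaf carries exactly one label.\<close>

definition leaf_count :: "(nat \<Rightarrow> nat) \<Rightarrow> nat \<Rightarrow> nat \<Rightarrow> nat \<Rightarrow> nat" where
  "leaf_count lam k s n = card {v \<in> skel_leaves lam k. \<exists>l\<in>labels lam k s v. l \<le> n}"

definition rec_poly :: "(nat \<Rightarrow> nat) \<Rightarrow> nat \<Rightarrow> 'a::comm_ring_1 poly" where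
  "rec_poly lam k = monom 1 k - (\<Sum>i=1..k. monom (of_nat (lam i)) (k - i))"

end

theory Submission imports Defs "HOL-Real_Asymp.Real_Asymp" begin

text \<open>
  Let \<open>n\<^sub>j\<close> be the number of nodes and \<open>a\<^sub>j\<close> the number of leaves of \<open>T\<^sub>j\<close>. Then
  \<open>n\<^sub>j = 1 + \<Sum>\<^sub>i \<lambda>\<^sub>i n\<^sub>j\<^sub>-\<^sub>i\<close> and \<open>a\<^sub>j = n\<^sub>j - n\<^sub>j\<^sub>-\<^sub>1\<close>, because deleting the leaves of \<open>T\<^sub>j\<close> leaves \<open>T\<^sub>j\<^sub>-\<^sub>1\<close>.
  After a shift that makes the recurrence homogeneous, \<open>n\<^sub>j / \<kappa>\<^sup>j\<close> satisfies a recurrence with convex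
  weights and converges to a positive limit, so \<open>a\<^sub>j / n\<^sub>j\<close> tends to \<open>1 - 1 / \<kappa>\<close>.

  An initial segment of the traversal that ends in the \<open>i\<close>-th branch is a disjoint union of
  \<open>O(i\<^sup>2)\<close> single nodes and complete copies of trees \<open>T\<^sub>j\<close>. As its length is exponential in \<open>i\<close>, its leaf
  density also tends to \<open>1 - 1 / \<kappa>\<close>, and it contains only \<open>O(i)\<close> supernodes, so \<open>s\<close> has no influence
  on the limit.
\<close>

section \<open>The dominant root\<close>

lemma poly_rec_poly:
  "poly (rec_poly lam k) x = x ^ k - (\<Sum>i=1..k. of_nat (lam i) * x ^ (k - i))"
  by (simp add: rec_poly_def poly_monom poly_sum)

text \<open>Dividing by \<open>x ^ k\<close> passes to the inverse variable, in which the root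
  condition has nonnegative coefficients and is monotone on the nonnegative reals.\<close>

lemma poly_rec_poly_eq_0_iff:
  fixes x :: "'a :: field"
  assumes "x \<noteq> 0"
  shows "poly (rec_poly lam k) x = 0 \<longleftrightarrow> (\<Sum>i=1..k. of_nat (lam i) * inverse x ^ i) = 1"
proof -
  have "(\<Sum>i=1..k. of_nat (lam i) * x ^ (k - i)) = x ^ k * (\<Sum>i=1..k. of_nat (lam i) * inverse x ^ i)"
    unfolding sum_distrib_left
  proof (rule sum.cong)
    fix i assume "i \<in> {1..k}"
    hence "x ^ (k - i) = x ^ k * inverse x ^ i"
      using assms by (simp add: power_diff field_simps)
    thus "of_nat (lam i) * x ^ (k - i) = x ^ k * (of_nat (lam i) * inverse x ^ i)"
      by simp
  qed simp
  hence "poly (rec_poly lam k) x = x ^ k * (1 - (\<Sum>i=1..k. of_nat (lam i) * inverse x ^ i))"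
    by (simp add: poly_rec_poly algebra_simps)
  thus ?thesis using assms by auto
qed

lemma weighted_power_sum_strict_mono:
  fixes x y :: real
  assumes "k \<ge> 1" "lam 1 \<ge> 1" "0 \<le> x" "x < y"
  shows "(\<Sum>i=1..k. of_nat (lam i) * x ^ i) < (\<Sum>i=1..k. of_nat (lam i) * y ^ i)"
proof (rule sum_strict_mono_ex1)
  show "\<forall>i\<in>{1..k}. of_nat (lam i) * x ^ i \<le> of_nat (lam i) * y ^ i"
    using assms by (auto intro!: mult_left_mono power_mono)
  show "\<exists>i\<in>{1..k}. of_nat (lam i) * x ^ i < of_nat (lam i) * y ^ i"
    using assms by (intro bexI[of _ 1]) auto
qed simp

section \<open>Recurrences with convex weights\<close>

text \<open>Beyond the window each value is a convex combination of the \<open>k\<close> preceding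
  ones, so bounds on \<open>k\<close> consecutive values propagate.\<close>

lemma convex_recurrence_bounds:
  fixes b q :: "nat \<Rightarrow> real"
  assumes "\<And>i. q i \<ge> 0" "(\<Sum>i=1..k. q i) = 1"
    and rec: "\<And>j. j \<ge> k \<Longrightarrow> b j = (\<Sum>i=1..k. q i * b (j - i))"
    and win: "\<And>l. n \<le> l \<Longrightarrow> l < n + k \<Longrightarrow> lo \<le> b l \<and> b l \<le> hi"
  shows "n \<le> l \<Longrightarrow> lo \<le> b l \<and> b l \<le> hi"
proof (induction l rule: less_induct)
  case (less l)
  show ?case
  proof (cases "l < n + k")
    case True
    thus ?thesis using win less.prems by blast
  next
    case False
    have IH: "lo \<le> b (l - i) \<and> b (l - i) \<le> hi" if "i \<in> {1..k}" for i
      using that False by (intro less.IH) auto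
    have "(\<Sum>i=1..k. q i * lo) \<le> (\<Sum>i=1..k. q i * b (l - i))"
      "(\<Sum>i=1..k. q i * b (l - i)) \<le> (\<Sum>i=1..k. q i * hi)"
      using IH assms(1) by (auto intro!: sum_mono mult_left_mono)
    thus ?thesis using rec[of l] False assms(2) by (simp flip: sum_distrib_right)
  qed
qed

text \<open>The oscillation over a window of length \<open>k\<close> contracts: as \<open>q 1 > 0\<close>, a maximal value in one
  window lifts every value of the next window above the old minimum.\<close>

lemma convex_recurrence_converges:
  fixes b q :: "nat \<Rightarrow> real"
  assumes k: "k \<ge> 1" and q: "\<And>i. q i \<ge> 0" "q 1 > 0" and q1: "(\<Sum>i=1..k. q i) = 1"
    and pos: "\<And>j. b j > 0"
    and rec: "\<And>j. j \<ge> k \<Longrightarrow> b j = (\<Sum>i=1..k. q i * b (j - i))"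
  shows "\<exists>c>0. b \<longlonglongrightarrow> c"
proof -
  define M where "M n = Max (b ` {n..<n+k})" for n
  define m where "m n = Min (b ` {n..<n+k})" for n
  \<comment> \<open>At most \<open>2 * k\<close> indices separate a maximum in the window at
    \<open>n + k\<close> from a minimum in the window at \<open>n + 2 * k\<close>, and each step
    costs a factor \<open>q 1\<close>.\<close>
  define \<delta> where "\<delta> = q 1 ^ (2 * k)"
  have ne: "b ` {n..<n+k} \<noteq> {}" for n using k by auto
  have win: "m n \<le> b l \<and> b l \<le> M n" if "n \<le> l" for n l
    by (rule convex_recurrence_bounds[OF q(1) q1 rec _ that]) (auto simp: m_def M_def)
  have m_in: "\<exists>l\<ge>n. l < n + k \<and> m n = b l" for n
    using Min_in[OF _ ne[of n]] unfolding m_def by auto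
  have M_in: "\<exists>l\<ge>n. l < n + k \<and> M n = b l" for n
    using Max_in[OF _ ne[of n]] unfolding M_def by auto
  have inc: "incseq m" unfolding incseq_def
    by (metis m_in win le_trans)
  have dec: "decseq M" unfolding decseq_def
    by (metis M_in win le_trans)
  have mM: "m n \<le> M n" for n using win[of n n] by simp
  have q1le: "q 1 \<le> 1"
    using member_le_sum[of 1 "{1..k}" q] q q1 k by auto
  \<comment> \<open>Since the weights sum to 1, \<open>m n\<close> can be subtracted inside the
    recurrence; all summands are then nonnegative and only \<open>i = 1\<close> is kept.\<close>
  have step: "b (Suc l) - m n \<ge> q 1 * (b l - m n)" if "n + k \<le> Suc l" for n l
  proof -
    have "b (Suc l) - m n = (\<Sum>i=1..k. q i * (b (Suc l - i) - m n))"
      using rec[of "Suc l"] that q1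
      by (simp add: right_diff_distrib sum_subtractf flip: sum_distrib_right)
    also have "\<dots> \<ge> q 1 * (b (Suc l - 1) - m n)"
      using that k win[of n] q
      by (intro member_le_sum[of 1 "{1..k}" "\<lambda>i. q i * (b (Suc l - i) - m n)"])
        (auto intro!: mult_nonneg_nonneg)
    finally show ?thesis by simp
  qed
  have lift: "b (l + r) - m n \<ge> q 1 ^ r * (b l - m n)" if "n + k \<le> Suc l" for n l r
  proof (induction r)
    case (Suc r)
    have "q 1 ^ Suc r * (b l - m n) \<le> q 1 * (b (l + r) - m n)"
      using Suc q by (simp add: mult.assoc mult_left_mono)
    also have "\<dots> \<le> b (l + Suc r) - m n" using step[of n "l + r"] that by simp
    finally show ?case .
  qed simp
  have key: "M (n + 2 * k) - m (n + 2 * k) \<le> (1 - \<delta>) * (M n - m n)" for n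
  proof -
    obtain l where l: "n + k \<le> l" "l < n + k + k" "M (n + k) = b l" using M_in by blast
    obtain l' where l': "n + 2 * k \<le> l'" "l' < n + 2 * k + k" "m (n + 2 * k) = b l'"
      using m_in by blast
    define r where "r = l' - l"
    have r: "l' = l + r" "r \<le> 2 * k" using l l' unfolding r_def by auto
    have "\<delta> \<le> q 1 ^ r" unfolding \<delta>_def using q1le q r by (intro power_decreasing) auto
    hence "\<delta> * (b l - m n) \<le> q 1 ^ r * (b l - m n)"
      using win[of n l] l by (intro mult_right_mono) auto
    also have "\<dots> \<le> m (n + 2 * k) - m n" using lift[of n l r] l l' r by simp
    finally have A: "\<delta> * (M (n + k) - m n) \<le> m (n + 2 * k) - m n" using l by simp
    have "\<delta> \<le> 1" unfolding \<delta>_def using q1le q by (intro power_le_one) auto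
    moreover have "M (n + 2 * k) \<le> M (n + k)" "M (n + k) \<le> M n"
      using dec by (auto simp: decseq_def)
    ultimately have "(1 - \<delta>) * (M (n + k) - m n) \<le> (1 - \<delta>) * (M n - m n)"
      by (intro mult_left_mono) auto
    with A \<open>M (n + 2 * k) \<le> M (n + k)\<close> show ?thesis by (simp add: algebra_simps)
  qed
  define D where "D n = M n - m n" for n
  have "decseq D" using inc dec unfolding D_def decseq_def incseq_def by (meson diff_mono)
  moreover have D0: "D n \<ge> 0" for n using mM unfolding D_def by simp
  ultimately obtain L where L: "D \<longlonglongrightarrow> L"
    by (metis decseq_convergent)
  have "(\<lambda>n. D (n + 2 * k)) \<longlonglongrightarrow> L" using L by (rule LIMSEQ_ignore_initial_segment)
  \<comment> \<open>The contraction \<open>key\<close> passes to the limit and forces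
    \<open>L = 0\<close>.\<close>
  hence "L \<le> (1 - \<delta>) * L"
    by (rule LIMSEQ_le[OF _ tendsto_mult[OF tendsto_const L]]) (use key in \<open>auto simp: D_def\<close>)
  hence "\<delta> * L \<le> 0" by (simp add: algebra_simps)
  moreover have "\<delta> > 0" unfolding \<delta>_def using q by simp
  ultimately have "L \<le> 0" by (simp add: mult_le_0_iff)
  moreover have "L \<ge> 0" using L D0 by (intro LIMSEQ_le_const[OF L]) auto
  ultimately have D: "D \<longlonglongrightarrow> 0" using L by simp
  have "m n \<le> M 0" for n using mM[of n] dec by (auto simp: decseq_def intro: order_trans)
  then obtain c where c: "m \<longlonglongrightarrow> c" "\<And>n. m n \<le> c"
    using incseq_convergent[OF inc] by blast
  have "b \<longlonglongrightarrow> c"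
  proof (rule tendsto_sandwich[OF _ _ c(1)])
    show "(\<lambda>n. m n + D n) \<longlonglongrightarrow> c" using tendsto_add[OF c(1) D] by simp
  qed (use win in \<open>auto simp: D_def\<close>)
  moreover have "c > 0" using c(2)[of 0] m_in[of 0] pos by (metis less_le_trans)
  ultimately show ?thesis by blast
qed

section \<open>Sublinear errors\<close>

text \<open>The finitely many indices before the limit estimate takes hold are absorbed into
  \<open>C\<close>. Unlike limits, such bounds hold for every index and can be added over the pieces
  of a traversal.\<close>

lemma tendsto_0_imp_affine_bound:
  fixes f g :: "nat \<Rightarrow> real"
  assumes "(\<lambda>j. f j / g j) \<longlonglongrightarrow> 0" "\<And>j. g j > 0" "\<epsilon> > 0"
  shows "\<exists>C\<ge>0. \<forall>j. \<bar>f j\<bar> \<le> \<epsilon> * g j + C"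
proof -
  obtain N where N: "\<And>j. j \<ge> N \<Longrightarrow> \<bar>f j / g j\<bar> < \<epsilon>"
    using LIMSEQ_D[OF assms(1,3)] by auto
  have "\<bar>f j\<bar> \<le> \<epsilon> * g j + (\<Sum>i<N. \<bar>f i\<bar>)" for j
  proof (cases "j < N")
    case True
    hence "\<bar>f j\<bar> \<le> (\<Sum>i<N. \<bar>f i\<bar>)" by (intro member_le_sum) auto
    moreover have "\<epsilon> * g j \<ge> 0" using assms(2)[of j] assms(3) by simp
    ultimately show ?thesis by linarith
  next
    case False
    hence "\<bar>f j\<bar> \<le> \<epsilon> * g j" using N[of j] assms(2)[of j] by (simp add: abs_divide field_simps)
    moreover have "(\<Sum>i<N. \<bar>f i\<bar>) \<ge> 0" by (intro sum_nonneg) auto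
    ultimately show ?thesis by linarith
  qed
  moreover have "(\<Sum>i<N. \<bar>f i\<bar>) \<ge> 0" by (intro sum_nonneg) auto
  ultimately show ?thesis by blast
qed

lemma affine_bound_imp_tendsto:
  fixes f :: "nat \<Rightarrow> real"
  assumes "\<And>\<epsilon>. \<epsilon> > 0 \<Longrightarrow> \<exists>C. \<forall>n. \<bar>f n - \<rho> * real n\<bar> \<le> \<epsilon> * real n + C"
  shows "(\<lambda>n. f n / real n) \<longlonglongrightarrow> \<rho>"
proof (rule LIMSEQ_I)
  fix e :: real assume "e > 0"
  then obtain C where C: "\<And>n. \<bar>f n - \<rho> * real n\<bar> \<le> e / 2 * real n + C"
    using assms[of "e / 2"] by auto
  obtain N where N: "real N > 2 * C / e" using reals_Archimedean2 by blast
  have "norm (f n / real n - \<rho>) < e" if "n \<ge> Suc N" for n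
  proof -
    have "e * real n > 2 * C"
      using N that \<open>e > 0\<close> by (simp add: field_simps) (smt (verit) mult_left_mono of_nat_le_iff Suc_leD)
    hence "\<bar>f n - \<rho> * real n\<bar> < e * real n" using C[of n] by linarith
    moreover have "f n / real n - \<rho> = (f n - \<rho> * real n) / real n"
      using that by (simp add: field_simps)
    ultimately show ?thesis using that by (simp add: abs_divide field_simps)
  qed
  thus "\<exists>no. \<forall>n\<ge>no. norm (f n / real n - \<rho>) < e" by blast
qed


section \<open>Leaf flags in preorder\<close>

text \<open>Counting needs only the leaf indicators in preorder, not the addresses.\<close>

primrec flags :: "otree \<Rightarrow> bool list" where
  "flags (Node ts) = (ts = []) # concat (map flags ts)"

lemma map_leaf_preorder: "map (\<lambda>p. subtrees (subtree_at t p) = []) (preorder t) = flags t"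
proof (induction t)
  case (Node ts)
  let ?f = "\<lambda>p. subtrees (subtree_at (Node ts) p) = []"
  have "map (map ?f) (map2 (\<lambda>m ps. map ((#) m) ps) [0..<length ts] (map preorder ts)) = map flags ts"
    by (rule nth_equalityI) (use Node in \<open>auto simp: o_def\<close>)
  thus ?case by (simp add: map_concat)
qed

lemma preorder_not_Nil: "preorder t \<noteq> []"
  by (cases t) simp

lemma length_preorder: "length (preorder t) = length (flags t)"
  by (metis length_map map_leaf_preorder)

lemma distinct_concat_map_upt:
  assumes "\<And>i. i < n \<Longrightarrow> distinct (f i)"
    and "\<And>i j. i < j \<Longrightarrow> j < n \<Longrightarrow> set (f i) \<inter> set (f j) = {}"
  shows "distinct (concat (map f [0..<n]))"
  using assms
proof (induction n)
  case (Suc n)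
  have "set (concat (map f [0..<n])) \<inter> set (f n) = {}"
    using Suc.prems(2)[of _ n] by fastforce
  moreover have "distinct (concat (map f [0..<n]))" using Suc by simp
  ultimately show ?case using Suc.prems(1)[of n] by simp
qed simp

lemma distinct_preorder: "distinct (preorder t)"
proof (induction t)
  case (Node ts)
  let ?f = "\<lambda>i. map ((#) i) (preorder (ts ! i))"
  have "map2 (\<lambda>m ps. map ((#) m) ps) [0..<length ts] (map preorder ts) = map ?f [0..<length ts]"
    by (rule nth_equalityI) auto
  moreover have "distinct (concat (map ?f [0..<length ts]))"
    using Node by (intro distinct_concat_map_upt) (auto simp: distinct_map)
  ultimately show ?case by auto
qed

section \<open>Deviation from a leaf density\<close>

text \<open>The part of the deviation from density \<open>\<rho>\<close> not covered by a tolerance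
  of \<open>\<epsilon>\<close> per node. It is subadditive under concatenation, so a traversal can
  be cut into pieces and their costs added.\<close>

definition exc :: "real \<Rightarrow> real \<Rightarrow> bool list \<Rightarrow> real" where
  "exc \<rho> \<epsilon> xs = \<bar>real (count_list xs True) - \<rho> * real (length xs)\<bar> - \<epsilon> * real (length xs)"

lemma exc_Nil [simp]: "exc \<rho> \<epsilon> [] = 0"
  by (simp add: exc_def)

lemma exc_append: "exc \<rho> \<epsilon> (xs @ ys) \<le> exc \<rho> \<epsilon> xs + exc \<rho> \<epsilon> ys"
  by (simp add: exc_def algebra_simps)

lemma exc_Cons:
  assumes "0 \<le> \<rho>" "\<rho> \<le> 1" "0 \<le> \<epsilon>"
  shows "exc \<rho> \<epsilon> (x # xs) \<le> 1 + exc \<rho> \<epsilon> xs"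
proof -
  have "exc \<rho> \<epsilon> [x] \<le> 1" using assms by (auto simp: exc_def)
  thus ?thesis using exc_append[of \<rho> \<epsilon> "[x]" xs] by simp
qed

lemma exc_concat_replicate:
  assumes "exc \<rho> \<epsilon> xs \<le> K"
  shows "exc \<rho> \<epsilon> (concat (replicate c xs)) \<le> real c * K"
proof (induction c)
  case (Suc c)
  show ?case using exc_append[of \<rho> \<epsilon> xs "concat (replicate c xs)"] Suc assms
    by (simp add: algebra_simps)
qed simp

text \<open>The cut falls into at most one copy, which costs \<open>E\<close>; the complete copies
  before it cost at most \<open>K\<close> each.\<close>

lemma exc_take_concat_replicate:
  assumes "exc \<rho> \<epsilon> xs \<le> K" "K \<ge> 0" "\<And>m. exc \<rho> \<epsilon> (take m xs) \<le> E"
  shows "exc \<rho> \<epsilon> (take m (concat (replicate c xs))) \<le> real c * K + E"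
proof (induction c arbitrary: m)
  case 0
  show ?case using assms(3)[of 0] by simp
next
  case (Suc c)
  show ?case
  proof (cases "m \<le> length xs")
    case True
    have "real (Suc c) * K \<ge> 0" using assms(2) by simp
    thus ?thesis using True assms(3)[of m] by simp
  next
    case False
    have "exc \<rho> \<epsilon> (take m (concat (replicate (Suc c) xs)))
        \<le> exc \<rho> \<epsilon> xs + exc \<rho> \<epsilon> (take (m - length xs) (concat (replicate c xs)))"
      using False exc_append[of \<rho> \<epsilon> xs] by simp
    also have "\<dots> \<le> K + (real c * K + E)" using Suc assms(1) by (intro add_mono)
    finally show ?thesis by (simp add: algebra_simps)
  qed
qed

section \<open>Node and leaf counts\<close>

locale skeleton =
  fixes lam :: "nat \<Rightarrow> nat" and k :: nat
  assumes k1: "k \<ge> 1" and lam1: "lam 1 \<ge> 1" and lamk: "lam k \<ge> 1"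
    and lam0: "\<And>i. i > k \<Longrightarrow> lam i = 0" and order1: "k = 1 \<Longrightarrow> lam 1 \<ge> 2"
begin

definition nodes :: "nat \<Rightarrow> real" where
  "nodes j = real (length (flags (fin_tree lam j)))"

definition leaves :: "nat \<Rightarrow> real" where
  "leaves j = real (count_list (flags (fin_tree lam j)) True)"

lemma Lam_pos: "j \<ge> 1 \<Longrightarrow> Lam lam j \<ge> 1"
  unfolding Lam_def using lam1 member_le_sum[of 1 "{1..j}" lam] by auto

lemma Lam_le: "Lam lam j \<le> Lam lam k"
proof -
  have "Lam lam j = (\<Sum>i\<in>{1..j} \<inter> {1..k}. lam i)"
    unfolding Lam_def using lam0 by (intro sum.mono_neutral_right) auto
  also have "\<dots> \<le> Lam lam k" unfolding Lam_def by (intro sum_mono2) auto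
  finally show ?thesis .
qed

text \<open>This makes every supernode have a non-special child and places the inverse root strictly
  below 1.\<close>

lemma Lam_ge_2: "Lam lam k \<ge> 2"
proof (cases "k = 1")
  case True
  thus ?thesis using order1 by (simp add: Lam_def)
next
  case False
  have "(\<Sum>i\<in>{1, k}. lam i) \<le> Lam lam k" unfolding Lam_def using k1 by (intro sum_mono2) auto
  thus ?thesis using False lam1 lamk by simp
qed

text \<open>The chain itself has \<open>1 + i\<close> nodes, and its special node on level
  \<open>l + 1\<close> carries \<open>Lam lam (j - l) - 1\<close> copies of the tree of index
  \<open>l\<close>.\<close>

lemma length_flags_chain:
  assumes "i \<le> j"
  shows "real (length (flags (chain lam j i))) = 1 + real i + (\<Sum>l<i. (real (Lam lam (j - l)) - 1) * nodes l)"
  using assms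
proof (induction i)
  case (Suc i)
  have "real (Lam lam (j - i) - 1) = real (Lam lam (j - i)) - 1"
    using Lam_pos[of "j - i"] Suc.prems by (simp add: of_nat_diff)
  thus ?case using Suc
    by (simp add: length_concat sum_list_replicate nodes_def fin_tree_def)
qed simp

text \<open>The same count, except that only the lowest node of the chain is a leaf.\<close>

lemma leaves_flags_chain:
  assumes "i \<le> j"
  shows "real (count_list (flags (chain lam j i)) True) = 1 + (\<Sum>l<i. (real (Lam lam (j - l)) - 1) * leaves l)"
  using assms
proof (induction i)
  case (Suc i)
  have "real (Lam lam (j - i) - 1) = real (Lam lam (j - i)) - 1"
    using Lam_pos[of "j - i"] Suc.prems by (simp add: of_nat_diff)
  moreover have "count_list (concat (replicate c xs)) True = c * count_list xs True" for c and xs :: "bool list"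
    by (induction c) auto
  ultimately show ?case using Suc
    by (simp add: leaves_def fin_tree_def)
qed simp

lemma nodes_eq: "nodes j = 1 + real j + (\<Sum>l<j. (real (Lam lam (j - l)) - 1) * nodes l)"
  using length_flags_chain[of j j] by (simp add: nodes_def fin_tree_def)

lemma leaves_eq: "leaves j = 1 + (\<Sum>l<j. (real (Lam lam (j - l)) - 1) * leaves l)"
  using leaves_flags_chain[of j j] by (simp add: leaves_def fin_tree_def)

lemma nodes_0: "nodes 0 = 1" and leaves_0: "leaves 0 = 1"
  by (simp_all add: nodes_eq[of 0] leaves_eq[of 0])

text \<open>Instead of deleting leaves, the proof compares recurrences: the differences of
  consecutive node counts obey the recurrence of the shifted leaf counts, with the same initial
  term.\<close>

lemma nodes_Suc_eq: "nodes (Suc j) = nodes j + leaves (Suc j)"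
proof (induction j rule: less_induct)
  case (less j)
  have "nodes (Suc j) - nodes j = 1 + (real (Lam lam (Suc j)) - 1) * nodes 0
      + (\<Sum>l<j. (real (Lam lam (j - l)) - 1) * (nodes (Suc l) - nodes l))"
    unfolding nodes_eq[of "Suc j"] nodes_eq[of j] sum.lessThan_Suc_shift
    by (simp add: right_diff_distrib sum_subtractf)
  also have "(\<Sum>l<j. (real (Lam lam (j - l)) - 1) * (nodes (Suc l) - nodes l))
      = (\<Sum>l<j. (real (Lam lam (j - l)) - 1) * leaves (Suc l))"
    using less by (intro sum.cong) auto
  also have "1 + (real (Lam lam (Suc j)) - 1) * nodes 0 + \<dots> = leaves (Suc j)"
    unfolding leaves_eq[of "Suc j"] sum.lessThan_Suc_shift by (simp add: nodes_0 leaves_0)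
  finally show ?case by simp
qed

text \<open>Taking differences in \<open>nodes_eq\<close> turns the partial sums \<open>Lam\<close>
  into the single coefficients \<open>lam\<close>.\<close>

lemma nodes_Suc_rec: "nodes (Suc j) = 1 + (\<Sum>l<Suc j. real (lam (Suc j - l)) * nodes l)"
proof -
  have Lam_Suc: "real (Lam lam (Suc j - l)) = real (Lam lam (j - l)) + real (lam (Suc j - l))"
    if "l < Suc j" for l
    using that by (simp add: Lam_def Suc_diff_le)
  have "nodes (Suc j) - nodes j = 1 + (\<Sum>l<Suc j. (real (Lam lam (Suc j - l)) - 1) * nodes l)
      - (\<Sum>l<j. (real (Lam lam (j - l)) - 1) * nodes l)"
    unfolding nodes_eq[of "Suc j"] nodes_eq[of j] by simp
  \<comment> \<open>The added term \<open>l = j\<close> has coefficient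
    \<open>Lam lam 0 - 1 = -1\<close>.\<close>
  also have "(\<Sum>l<j. (real (Lam lam (j - l)) - 1) * nodes l)
      = (\<Sum>l<Suc j. (real (Lam lam (j - l)) - 1) * nodes l) + nodes j"
    by (simp add: Lam_def)
  also have "1 + (\<Sum>l<Suc j. (real (Lam lam (Suc j - l)) - 1) * nodes l) -
      ((\<Sum>l<Suc j. (real (Lam lam (j - l)) - 1) * nodes l) + nodes j)
     = 1 + (\<Sum>l<Suc j. real (lam (Suc j - l)) * nodes l) - nodes j"
    using Lam_Suc
    by (simp add: algebra_simps sum.distrib sum_subtractf del: sum.lessThan_Suc)
  finally show ?thesis by simp
qed

lemma nodes_rec:
  assumes "j \<ge> k"
  shows "nodes j = 1 + (\<Sum>i=1..k. real (lam i) * nodes (j - i))"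
proof -
  obtain j' where j: "j = Suc j'" using assms k1 by (cases j) auto
  have "(\<Sum>l<j. real (lam (j - l)) * nodes l) = (\<Sum>i=1..j. real (lam i) * nodes (j - i))"
    by (rule sum.reindex_bij_witness[of _ "\<lambda>i. j - i" "\<lambda>l. j - l"]) auto
  also have "\<dots> = (\<Sum>i=1..k. real (lam i) * nodes (j - i))"
    using lam0 assms by (intro sum.mono_neutral_right) auto
  finally show ?thesis using nodes_Suc_rec[of j'] j by simp
qed

lemma nodes_ge_1: "nodes j \<ge> 1"
  unfolding nodes_def by (cases "fin_tree lam j") simp

text \<open>Adding \<open>1 / (\<Lambda> - 1)\<close> to the node counts makes their recurrence homogeneous.\<close>

lemma nodes_asymp:
  fixes y :: real
  assumes y: "0 < y" "y < 1" and root: "(\<Sum>i=1..k. real (lam i) * y ^ i) = 1"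
  shows "\<exists>c>0. (\<lambda>j. nodes j * y ^ j) \<longlonglongrightarrow> c"
proof -
  define \<mu> where "\<mu> = 1 / (real (Lam lam k) - 1)"
  have Lam: "real (Lam lam k) \<ge> 2" using Lam_ge_2 by linarith
  have mu: "\<mu> > 0" using Lam by (simp add: \<mu>_def)
  \<comment> \<open>This identity lets the shift by \<open>\<mu>\<close> absorb the constant 1 of
    \<open>nodes_rec\<close>.\<close>
  have mu2: "real (Lam lam k) * \<mu> = 1 + \<mu>" using Lam by (simp add: \<mu>_def field_simps)
  \<comment> \<open>The factor \<open>y ^ j\<close> turns the coefficients into
    \<open>lam i * y ^ i\<close>, which sum to 1 by \<open>root\<close>.\<close>
  define b where "b j = (nodes j + \<mu>) * y ^ j" for j
  have "\<exists>c>0. b \<longlonglongrightarrow> c"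
  proof (rule convex_recurrence_converges[OF k1])
    show "0 \<le> real (lam i) * y ^ i" for i using y by simp
    show "0 < real (lam 1) * y ^ 1" using y lam1 by simp
    show "(\<Sum>i=1..k. real (lam i) * y ^ i) = 1" by (rule root)
    show "0 < b j" for j using nodes_ge_1[of j] mu y by (simp add: b_def)
    fix j assume j: "j \<ge> k"
    have "(\<Sum>i=1..k. real (lam i) * y ^ i * b (j - i))
        = (\<Sum>i=1..k. y ^ j * (real (lam i) * nodes (j - i) + real (lam i) * \<mu>))"
    proof (rule sum.cong)
      fix i assume "i \<in> {1..k}"
      hence "y ^ i * y ^ (j - i) = y ^ j" using j by (simp flip: power_add)
      thus "real (lam i) * y ^ i * b (j - i) = y ^ j * (real (lam i) * nodes (j - i) + real (lam i) * \<mu>)"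
        by (simp add: b_def algebra_simps)
    qed simp
    also have "\<dots> = y ^ j * ((\<Sum>i=1..k. real (lam i) * nodes (j - i)) + real (Lam lam k) * \<mu>)"
      by (simp add: sum.distrib Lam_def flip: sum_distrib_left sum_distrib_right)
    also have "\<dots> = b j" using nodes_rec[OF j] mu2 by (simp add: b_def)
    finally show "b j = (\<Sum>i=1..k. real (lam i) * y ^ i * b (j - i))" by simp
  qed
  then obtain c where c: "c > 0" "b \<longlonglongrightarrow> c" by blast
  have "(\<lambda>j. b j - \<mu> * y ^ j) \<longlonglongrightarrow> c - \<mu> * 0"
    using y by (intro tendsto_diff c tendsto_mult tendsto_const LIMSEQ_power_zero) auto
  thus ?thesis using c(1) by (auto simp: b_def algebra_simps)
qed

text \<open>As \<open>nodes j * y ^ j\<close> has a nonzero limit,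
  \<open>nodes j / nodes (Suc j)\<close> tends to \<open>y\<close>; \<open>nodes_Suc_eq\<close>
  turns this ratio into the leaf density.\<close>

lemma leaves_deviation:
  fixes y :: real
  assumes y: "0 < y" "y < 1" and root: "(\<Sum>i=1..k. real (lam i) * y ^ i) = 1"
  shows "(\<lambda>j. (leaves j - (1 - y) * nodes j) / nodes j) \<longlonglongrightarrow> 0"
proof -
  obtain c where c: "c > 0" "(\<lambda>j. nodes j * y ^ j) \<longlonglongrightarrow> c"
    using nodes_asymp[OF assms] by blast
  have "(\<lambda>j. y - y * (nodes j * y ^ j) / (nodes (Suc j) * y ^ Suc j)) \<longlonglongrightarrow> y - y * c / c"
    using c by (intro tendsto_intros LIMSEQ_Suc) auto
  moreover have "y - y * (nodes j * y ^ j) / (nodes (Suc j) * y ^ Suc j)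
      = (leaves (Suc j) - (1 - y) * nodes (Suc j)) / nodes (Suc j)" for j
  proof -
    have "y * (nodes j * y ^ j) / (nodes (Suc j) * y ^ Suc j) = nodes j / nodes (Suc j)"
      using y by simp
    moreover have "leaves (Suc j) = nodes (Suc j) - nodes j" using nodes_Suc_eq[of j] by simp
    ultimately show ?thesis using nodes_ge_1[of "Suc j"] by (simp add: field_simps)
  qed
  ultimately have "(\<lambda>j. (leaves (Suc j) - (1 - y) * nodes (Suc j)) / nodes (Suc j)) \<longlonglongrightarrow> 0"
    using c by simp
  thus ?thesis by (rule LIMSEQ_imp_Suc)
qed

text \<open>Node counts grow like \<open>inverse y ^ j\<close>. The shift by 4 fits the later use
  with \<open>i = j + 2\<close> in \<open>(i + 2)\<^sup>2\<close>.\<close>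

lemma square_over_nodes:
  fixes y :: real
  assumes y: "0 < y" "y < 1" and root: "(\<Sum>i=1..k. real (lam i) * y ^ i) = 1"
  shows "(\<lambda>j. (real j + 4)\<^sup>2 / nodes j) \<longlonglongrightarrow> 0"
proof -
  obtain c where c: "c > 0" "(\<lambda>j. nodes j * y ^ j) \<longlonglongrightarrow> c"
    using nodes_asymp[OF assms] by blast
  have "(\<lambda>j. (real j + 4)\<^sup>2 * y ^ j) \<longlonglongrightarrow> 0" using y by real_asymp
  hence "(\<lambda>j. ((real j + 4)\<^sup>2 * y ^ j) / (nodes j * y ^ j)) \<longlonglongrightarrow> 0 / c"
    using c by (intro tendsto_divide) auto
  thus ?thesis using y by simp
qed

end


text \<open>Used labels always form an initial segment, so this case evaluates the whole
  labeling.\<close>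

lemma smallest_unused_atLeastAtMost: "smallest_unused m {1..N} = {N+1..N+m}"
proof (induction m arbitrary: N)
  case (Suc m)
  have "(LEAST x. x \<ge> 1 \<and> x \<notin> {1..N}) = Suc N"
    by (rule Least_equality) auto
  moreover have "insert (Suc N) {1..N} = {1..Suc N}" by auto
  ultimately show ?case using Suc[of "Suc N"] by auto
qed simp

context skeleton
begin

section \<open>Leaf density along the traversal\<close>

context
  fixes \<rho> \<epsilon> K B :: real
  assumes rho: "0 \<le> \<rho>" "\<rho> \<le> 1" and eps: "0 \<le> \<epsilon>" and K0: "0 \<le> K"
    and K: "\<And>j. exc \<rho> \<epsilon> (flags (fin_tree lam j)) \<le> K"
    and B: "B = 1 + real (Lam lam k) * K"
begin

lemma copies_le: "real (Lam lam j - 1) * K \<le> real (Lam lam k) * K"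
  using Lam_le[of j] K0 by (intro mult_right_mono) auto

lemma B_ge_1: "B \<ge> 1"
  using K0 B by simp

text \<open>Each special node above the lowest costs at most 1 and its copies of a smaller tree at
  most \<open>Lam lam k * K\<close>, together \<open>B\<close>.\<close>

lemma exc_chain: "exc \<rho> \<epsilon> (flags (chain lam j i)) \<le> 1 + real i * B"
proof (induction i)
  case 0
  show ?case using exc_Cons[OF rho eps, of True "[]"] by simp
next
  case (Suc i)
  let ?r = "concat (replicate (Lam lam (j - i) - 1) (flags (chain lam i i)))"
  have "exc \<rho> \<epsilon> ?r \<le> real (Lam lam (j - i) - 1) * K"
    using K[of i] by (intro exc_concat_replicate) (simp add: fin_tree_def)
  moreover have "exc \<rho> \<epsilon> (flags (chain lam j (Suc i))) \<le> 1 + (exc \<rho> \<epsilon> (flags (chain lam j i)) + exc \<rho> \<epsilon> ?r)"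
    using exc_Cons[OF rho eps, of False "flags (chain lam j i) @ ?r"] exc_append[of \<rho> \<epsilon> "flags (chain lam j i)" ?r]
    by simp
  moreover have "real (Suc i) * B = real i * B + B" by (simp add: algebra_simps)
  ultimately show ?case using Suc copies_le[of "j - i"] B by linarith
qed

text \<open>A cut lies either in the remaining chain or in one copy of the tree of index
  \<open>i\<close>. In the second case the full chain adds a cost linear in \<open>i\<close> and the
  cut copy is handled by induction with \<open>j = i\<close>, so the total is quadratic.\<close>

lemma exc_take_chain: "exc \<rho> \<epsilon> (take m (flags (chain lam j i))) \<le> (real i + 1)\<^sup>2 * B"
proof (induction i arbitrary: j m)
  case 0
  show ?case using exc_Cons[OF rho eps, of True "[]"] B_ge_1 by (cases m) simp_all
next
  case (Suc i)
  note IH = Suc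
  let ?c = "flags (chain lam j i)"
  let ?r = "concat (replicate (Lam lam (j - i) - 1) (flags (chain lam i i)))"
  have r: "exc \<rho> \<epsilon> (take m ?r) \<le> real (Lam lam (j - i) - 1) * K + (real i + 1)\<^sup>2 * B" for m
    using K[of i] K0 Suc[of _ i] by (intro exc_take_concat_replicate) (simp_all add: fin_tree_def)
  have sq: "(real (Suc i) + 1)\<^sup>2 * B = (real i + 1)\<^sup>2 * B + real i * B + real i * B + B + B + B"
    by (simp add: power2_eq_square algebra_simps)
  have nn: "real i * B \<ge> 0" using B_ge_1 by simp
  show ?case
  proof (cases m)
    case 0
    thus ?thesis using B_ge_1 by simp
  next
    case (Suc m')
    have "exc \<rho> \<epsilon> (take m (flags (chain lam j (Suc i)))) \<le> 1 + exc \<rho> \<epsilon> (take m' (?c @ ?r))"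
      using exc_Cons[OF rho eps, of False] Suc by simp
    also have "exc \<rho> \<epsilon> (take m' (?c @ ?r)) \<le> (real i + 1)\<^sup>2 * B + real i * B + B + B"
    proof (cases "m' \<le> length ?c")
      case True
      hence "exc \<rho> \<epsilon> (take m' (?c @ ?r)) \<le> (real i + 1)\<^sup>2 * B" using IH[of m' j] by simp
      thus ?thesis using nn B_ge_1 by linarith
    next
      case False
      have "exc \<rho> \<epsilon> (take m' (?c @ ?r)) \<le> exc \<rho> \<epsilon> ?c + exc \<rho> \<epsilon> (take (m' - length ?c) ?r)"
        using False exc_append[of \<rho> \<epsilon> ?c] by simp
      also have "\<dots> \<le> (1 + real i * B) + (real (Lam lam k) * K + (real i + 1)\<^sup>2 * B)"
        using exc_chain[of j i] r[of "m' - length ?c"] copies_le[of "j - i"] by linarith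
      finally show ?thesis using B_ge_1 B by linarith
    qed
    finally show ?thesis using sq nn B_ge_1 by linarith
  qed
qed

lemma exc_branch: "exc \<rho> \<epsilon> (flags (branch lam k i)) \<le> B"
proof (cases i)
  case 0
  thus ?thesis using exc_Cons[OF rho eps, of True "[]"] B_ge_1 by simp
next
  case (Suc i')
  let ?r = "concat (replicate (Lam lam k - 1) (flags (fin_tree lam i')))"
  have "exc \<rho> \<epsilon> ?r \<le> real (Lam lam k - 1) * K"
    using K by (intro exc_concat_replicate)
  moreover have "exc \<rho> \<epsilon> (flags (branch lam k i)) \<le> 1 + exc \<rho> \<epsilon> ?r"
    using exc_Cons[OF rho eps, of _ ?r] Suc by simp
  ultimately show ?thesis using copies_le[of k] B by linarith
qed

lemma exc_take_branch: "exc \<rho> \<epsilon> (take m (flags (branch lam k i))) \<le> (real i + 1)\<^sup>2 * B"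
proof (cases "i = 0 \<or> m = 0")
  case True
  have "exc \<rho> \<epsilon> (take m (flags (branch lam k i))) \<le> (if m = 0 then 0 else 1)"
    using exc_Cons[OF rho eps, of True "[]"] True by (cases m) auto
  also have "\<dots> \<le> (real i + 1)\<^sup>2 * B"
    using mult_mono[of 1 "(real i + 1)\<^sup>2" 1 B] B_ge_1 by auto
  finally show ?thesis .
next
  case False
  then obtain i' m' where im: "i = Suc i'" "m = Suc m'" by (meson not0_implies_Suc)
  let ?r = "concat (replicate (Lam lam k - 1) (flags (fin_tree lam i')))"
  have "exc \<rho> \<epsilon> (take m' ?r) \<le> real (Lam lam k - 1) * K + (real i' + 1)\<^sup>2 * B"
    using K K0 exc_take_chain[of _ i' i']
    by (intro exc_take_concat_replicate) (simp_all add: fin_tree_def)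
  moreover have "exc \<rho> \<epsilon> (take m (flags (branch lam k i))) \<le> 1 + exc \<rho> \<epsilon> (take m' ?r)"
    using exc_Cons[OF rho eps, of _ "take m' ?r"] im by simp
  moreover have "(real i + 1)\<^sup>2 * B = (real i' + 1)\<^sup>2 * B + (2 * real i' * B + 2 * B) + B"
    using im by (simp add: power2_eq_square algebra_simps)
  moreover have "2 * real i' * B + 2 * B \<ge> 0" using B_ge_1 by simp
  ultimately show ?thesis using copies_le[of k] B by linarith
qed

end

section \<open>Finite prefixes of the traversal and their leaf patterns\<close>

definition conc :: "nat \<Rightarrow> node list" where
  "conc M = concat (map (branch_order lam k) [0..<M])"

definition cflags :: "nat \<Rightarrow> bool list" where
  "cflags M = concat (map (\<lambda>i. flags (branch lam k i)) [0..<M])"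

lemma conc_0 [simp]: "conc 0 = []" and conc_Suc: "conc (Suc M) = conc M @ branch_order lam k M"
  by (simp_all add: conc_def)

lemma cflags_0 [simp]: "cflags 0 = []" and cflags_Suc: "cflags (Suc M) = cflags M @ flags (branch lam k M)"
  by (simp_all add: cflags_def)

text \<open>The \<open>i\<close> complete branches cost a bounded amount each; only the branch
  containing the cut has quadratic cost.\<close>

lemma exc_take_cflags:
  assumes "0 \<le> \<rho>" "\<rho> \<le> 1" "0 \<le> \<epsilon>" "0 \<le> K" "\<And>j. exc \<rho> \<epsilon> (flags (fin_tree lam j)) \<le> K"
    and "t \<ge> length (cflags i)"
  shows "exc \<rho> \<epsilon> (take t (cflags (Suc i))) \<le> (real i + 2)\<^sup>2 * (1 + real (Lam lam k) * K)"
proof -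
  let ?B = "1 + real (Lam lam k) * K"
  have full: "exc \<rho> \<epsilon> (cflags i) \<le> real i * ?B" for i
  proof (induction i)
    case (Suc i)
    show ?case
      using exc_append[of \<rho> \<epsilon> "cflags i" "flags (branch lam k i)"] Suc exc_branch[OF assms(1-5) refl, of i]
      by (simp add: cflags_Suc algebra_simps)
  qed simp
  have "exc \<rho> \<epsilon> (take t (cflags (Suc i)))
      \<le> exc \<rho> \<epsilon> (cflags i) + exc \<rho> \<epsilon> (take (t - length (cflags i)) (flags (branch lam k i)))"
    using assms(6) exc_append[of \<rho> \<epsilon> "cflags i"] by (simp add: cflags_Suc)
  also have "\<dots> \<le> real i * ?B + (real i + 1)\<^sup>2 * ?B"
    by (intro add_mono full exc_take_branch[where K = K] assms refl)
  also have "\<dots> = (real i + (real i + 1)\<^sup>2) * ?B" by (simp add: algebra_simps)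
  also have "\<dots> \<le> (real i + 2)\<^sup>2 * ?B"
    using assms(4) by (intro mult_right_mono) (auto simp: power2_eq_square algebra_simps)
  finally show ?thesis .
qed

lemma length_conc: "length (conc M) = length (cflags M)"
  by (induction M) (simp_all add: conc_Suc cflags_Suc branch_order_def length_preorder)

lemma length_conc_ge: "M \<le> length (conc M)"
proof (induction M)
  case (Suc M)
  have "length (branch_order lam k M) \<ge> 1"
    using preorder_not_Nil[of "branch lam k M"] by (cases "preorder (branch lam k M)") (auto simp: branch_order_def)
  thus ?case using Suc by (simp add: conc_Suc)
qed simp

text \<open>Since \<open>Lam lam k \<ge> 2\<close>, the branch of index \<open>i + 1\<close>
  contains a copy of the tree of index \<open>i\<close>. Hence prefixes are exponentially long in
  the number of branches.\<close>

lemma length_conc_ge_nodes: "nodes i \<le> real (length (conc (i + 2)))"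
proof -
  obtain c where c: "Lam lam k - 1 = Suc c" using Lam_ge_2 by (cases "Lam lam k - 1") auto
  have "length (flags (fin_tree lam i)) \<le> length (flags (branch lam k (Suc i)))"
    unfolding branch.simps c by simp
  also have "\<dots> \<le> length (conc (i + 2))" by (simp add: length_conc cflags_Suc)
  finally show ?thesis by (simp add: nodes_def)
qed

lemma conc_mono: "M \<le> N \<Longrightarrow> \<exists>xs. conc N = conc M @ xs"
  by (induction N rule: dec_induct) (auto simp: conc_Suc)

text \<open>Of two prefixes one extends the other, so any sufficiently long one determines the node
  visited at time \<open>t\<close>.\<close>

lemma visit_eq:
  assumes "t < length (conc M)"
  shows "visit lam k t = conc M ! t"
proof -
  have "t < length (conc (Suc t))" using length_conc_ge[of "Suc t"] by simp
  moreover have "conc (Suc t) ! t = conc M ! t"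
    using conc_mono[of "Suc t" M] conc_mono[of M "Suc t"] assms calculation
    by (metis nat_le_linear nth_append)
  ultimately show ?thesis by (simp add: visit_def conc_def)
qed

lemma fst_conc: "v \<in> set (conc M) \<Longrightarrow> fst v < M"
  by (auto simp: conc_def branch_order_def)

lemma distinct_conc: "distinct (conc M)"
  unfolding conc_def branch_order_def
  by (intro distinct_concat_map_upt) (auto simp: distinct_map distinct_preorder inj_on_def)

lemma inj_visit: "inj (visit lam k)"
proof (rule injI)
  fix t t' assume eq: "visit lam k t = visit lam k t'"
  define M where "M = Suc (max t t')"
  have "t < length (conc M)" "t' < length (conc M)" using length_conc_ge[of M] by (auto simp: M_def)
  thus "t = t'" using eq distinct_conc[of M] by (simp add: visit_eq[of _ M] nth_eq_iff_index_eq)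
qed

text \<open>The special child of a supernode lies outside its branch, so leaf status could differ at
  a branch root; it does not, as each supernode also has children inside its branch.\<close>

lemma skel_leaves_iff:
  assumes "p \<in> set (preorder (branch lam k i))"
  shows "(i, p) \<in> skel_leaves lam k \<longleftrightarrow> subtrees (subtree_at (branch lam k i) p) = []"
proof -
  have "subtrees (branch lam k i) \<noteq> []" if "i \<ge> 1"
    using that Lam_ge_2 by (cases i) auto
  thus ?thesis using assms by (auto simp: skel_leaves_def skel_nodes_def is_supernode_def)
qed

lemma cflags_eq: "cflags M = map (\<lambda>v. v \<in> skel_leaves lam k) (conc M)"
proof (induction M)
  case (Suc M)
  have "map (\<lambda>v. v \<in> skel_leaves lam k) (branch_order lam k M) = flags (branch lam k M)"
    unfolding branch_order_def map_leaf_preorder[symmetric] by (simp add: skel_leaves_iff)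
  thus ?case using Suc by (simp add: conc_Suc cflags_Suc)
qed simp

definition leaf_visits :: "nat \<Rightarrow> nat set" where
  "leaf_visits t = {r. r < t \<and> visit lam k r \<in> skel_leaves lam k}"

definition super_visits :: "nat \<Rightarrow> nat set" where
  "super_visits t = {r. r < t \<and> is_supernode (visit lam k r)}"

lemma card_leaf_visits:
  assumes "t \<le> length (conc M)"
  shows "card (leaf_visits t) = count_list (take t (cflags M)) True"
  using assms
proof (induction t)
  case 0
  show ?case by (simp add: leaf_visits_def)
next
  case (Suc t)
  have "leaf_visits (Suc t) = (if visit lam k t \<in> skel_leaves lam k then insert t (leaf_visits t) else leaf_visits t)"
    by (auto simp: leaf_visits_def less_Suc_eq)
  moreover have "take (Suc t) (cflags M) = take t (cflags M) @ [visit lam k t \<in> skel_leaves lam k]"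
    using Suc.prems visit_eq[of t M]
    by (simp add: take_Suc_conv_app_nth length_conc[symmetric] cflags_eq)
  moreover have "finite (leaf_visits t)" "t \<notin> leaf_visits t" by (auto simp: leaf_visits_def)
  ultimately show ?case using Suc by simp
qed

text \<open>Only branch roots can be supernodes.\<close>

lemma card_super_visits:
  assumes "t \<le> length (conc M)"
  shows "card (super_visits t) \<le> M"
proof -
  have "visit lam k ` super_visits t \<subseteq> (\<lambda>i. (i, [])) ` {..<M}"
  proof
    fix v assume "v \<in> visit lam k ` super_visits t"
    then obtain r where r: "v = visit lam k r" "r < t" "snd v = []"
      by (auto simp: super_visits_def is_supernode_def)
    hence "v \<in> set (conc M)" using assms visit_eq[of r M] by simp
    thus "v \<in> (\<lambda>i. (i, [])) ` {..<M}" using fst_conc[of v M] r(3)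
      by (intro image_eqI[of _ _ "fst v"]) (auto simp: prod_eq_iff)
  qed
  hence "card (visit lam k ` super_visits t) \<le> card ((\<lambda>i. (i, [] :: nat list)) ` {..<M})"
    by (intro card_mono) auto
  also have "\<dots> \<le> M" using card_image_le[of "{..<M}"] by simp
  finally show ?thesis using card_image[OF inj_on_subset[OF inj_visit]] by simp
qed

lemma conc_position: "\<exists>i. length (conc i) \<le> t \<and> t < length (conc (Suc i))"
proof -
  define i where "i = (LEAST i. t < length (conc (Suc i)))"
  have ex: "t < length (conc (Suc t))" using length_conc_ge[of "Suc t"] by simp
  have 1: "t < length (conc (Suc i))" unfolding i_def by (rule LeastI[of _ t]) (rule ex)
  have "length (conc i) \<le> t"
  proof (cases i)
    case (Suc i')
    hence "\<not> t < length (conc (Suc i'))" unfolding i_def by (metis lessI not_less_Least)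
    thus ?thesis using Suc by simp
  qed simp
  thus ?thesis using 1 by blast
qed

section \<open>Leaf and supernode densities in visiting time\<close>

context
  fixes y :: real
  assumes y: "0 < y" "y < 1" and root: "(\<Sum>i=1..k. real (lam i) * y ^ i) = 1"
begin

lemma square_le_conc:
  assumes "\<epsilon> > 0"
  shows "\<exists>C\<ge>0. \<forall>i. (real i + 2)\<^sup>2 \<le> \<epsilon> * real (length (conc i)) + C"
proof -
  obtain C where C: "C \<ge> 0" "\<And>j. \<bar>(real j + 4)\<^sup>2\<bar> \<le> \<epsilon> * nodes j + C"
    using tendsto_0_imp_affine_bound[OF square_over_nodes[OF y root] _ assms] nodes_ge_1
    by (metis less_le_trans zero_less_one)
  \<comment> \<open>The 16 covers \<open>i < 2\<close>, where \<open>i\<close> is not of the form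
    \<open>j + 2\<close>.\<close>
  have "(real i + 2)\<^sup>2 \<le> \<epsilon> * real (length (conc i)) + (C + 16)" for i
  proof (cases "i \<ge> 2")
    case True
    then obtain j where j: "i = j + 2" by (metis le_add_diff_inverse2)
    have "\<epsilon> * nodes j \<le> \<epsilon> * real (length (conc i))"
      using length_conc_ge_nodes[of j] j assms by (intro mult_left_mono) auto
    moreover have "(real i + 2)\<^sup>2 = (real j + 4)\<^sup>2" using j by simp
    ultimately show ?thesis using C(2)[of j] by linarith
  next
    case False
    hence "(real i + 2)\<^sup>2 \<le> 4\<^sup>2" by (intro power_mono) auto
    moreover have "\<epsilon> * real (length (conc i)) \<ge> 0" using assms by simp
    ultimately show ?thesis using C(1) by simp
  qed
  thus ?thesis using C(1) by (intro exI[of _ "C + 16"]) auto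
qed

text \<open>Half of \<open>\<epsilon>\<close> is the tolerance per node in \<open>exc\<close>; the
  other half pays for the quadratic cost of cutting, scaled by \<open>B\<close>.\<close>

lemma leaf_visits_density:
  assumes "\<epsilon> > 0"
  shows "\<exists>C\<ge>0. \<forall>t. \<bar>real (card (leaf_visits t)) - (1 - y) * real t\<bar> \<le> \<epsilon> * real t + C"
proof -
  obtain K where K: "K \<ge> 0" "\<And>j. \<bar>leaves j - (1 - y) * nodes j\<bar> \<le> \<epsilon> / 2 * nodes j + K"
    using tendsto_0_imp_affine_bound[OF leaves_deviation[OF y root], of "\<epsilon> / 2"] nodes_ge_1 assms
    by (metis half_gt_zero less_le_trans zero_less_one)
  have exc: "exc (1 - y) (\<epsilon> / 2) (flags (fin_tree lam j)) \<le> K" for j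
    using K(2)[of j] by (simp add: exc_def leaves_def nodes_def)
  define B where "B = 1 + real (Lam lam k) * K"
  have B: "B > 0" unfolding B_def using K(1) by (simp add: add_pos_nonneg)
  obtain C where C: "C \<ge> 0" "\<And>i. (real i + 2)\<^sup>2 \<le> \<epsilon> / (2 * B) * real (length (conc i)) + C"
    using square_le_conc[of "\<epsilon> / (2 * B)"] B assms by auto
  have "\<bar>real (card (leaf_visits t)) - (1 - y) * real t\<bar> \<le> \<epsilon> * real t + C * B" for t
  proof -
    obtain i where i: "length (conc i) \<le> t" "t < length (conc (Suc i))"
      using conc_position by blast
    have "exc (1 - y) (\<epsilon> / 2) (take t (cflags (Suc i))) \<le> (real i + 2)\<^sup>2 * B"
      unfolding B_def using i y assms K(1) exc by (intro exc_take_cflags) (auto simp: length_conc)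
    also have "\<dots> \<le> (\<epsilon> / (2 * B) * real (length (conc i)) + C) * B"
      using C(2)[of i] B by (intro mult_right_mono) auto
    also have "\<dots> = \<epsilon> / 2 * real (length (conc i)) + C * B" using B by (simp add: field_simps)
    also have "\<dots> \<le> \<epsilon> / 2 * real t + C * B"
      using i assms by (intro add_right_mono mult_left_mono) auto
    finally have "exc (1 - y) (\<epsilon> / 2) (take t (cflags (Suc i))) \<le> \<epsilon> / 2 * real t + C * B" .
    moreover have "length (take t (cflags (Suc i))) = t" using i by (simp add: length_conc)
    ultimately show ?thesis
      using card_leaf_visits[of t "Suc i"] i by (simp add: exc_def)
  qed
  thus ?thesis using C(1) B by (intro exI[of _ "C * B"]) auto
qed

lemma super_visits_density:
  assumes "\<epsilon> > 0"
  shows "\<exists>C\<ge>0. \<forall>t. real (card (super_visits t)) \<le> \<epsilon> * real t + C"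
proof -
  obtain C where C: "C \<ge> 0" "\<And>i. (real i + 2)\<^sup>2 \<le> \<epsilon> * real (length (conc i)) + C"
    using square_le_conc[OF assms] by blast
  have "real (card (super_visits t)) \<le> \<epsilon> * real t + C" for t
  proof -
    obtain i where i: "length (conc i) \<le> t" "t < length (conc (Suc i))"
      using conc_position by blast
    have "real (card (super_visits t)) \<le> real i + 2" using card_super_visits[of t "Suc i"] i by simp
    also have "\<dots> \<le> (real i + 2)\<^sup>2" by (simp add: power2_eq_square)
    also have "\<dots> \<le> \<epsilon> * real (length (conc i)) + C" by (rule C)
    also have "\<dots> \<le> \<epsilon> * real t + C" using i assms by (intro add_right_mono mult_left_mono) auto
    finally show ?thesis .
  qed
  thus ?thesis using C(1) by blast
qed

end

section \<open>Labels\<close>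

definition label_total :: "nat \<Rightarrow> nat \<Rightarrow> nat" where
  "label_total s t = (\<Sum>r<t. label_count s (visit lam k r))"

lemma label_total_Suc: "label_total s (Suc t) = label_total s t + label_count s (visit lam k t)"
  by (simp add: label_total_def)

lemma used_labels_eq: "used_labels lam k s t = {1..label_total s t}"
proof (induction t)
  case 0
  show ?case by (simp add: label_total_def)
next
  case (Suc t)
  show ?case
    unfolding used_labels.simps Suc smallest_unused_atLeastAtMost by (auto simp: label_total_Suc)
qed

text \<open>Each node is visited only once, so the union in \<open>labels\<close> reduces to one
  block.\<close>

lemma labels_visit:
  "labels lam k s (visit lam k t) = {label_total s t + 1..label_total s t + label_count s (visit lam k t)}"
proof -
  have "{r. visit lam k r = visit lam k t} = {t}" using inj_visit by (auto dest: injD)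
  thus ?thesis unfolding labels_def used_labels_eq smallest_unused_atLeastAtMost by simp
qed

lemma label_count_leaf: "v \<in> skel_leaves lam k \<Longrightarrow> label_count s v = 1"
  by (cases v) (auto simp: skel_leaves_def label_count_def)

lemma label_total_mono: "t \<le> t' \<Longrightarrow> label_total s t \<le> label_total s t'"
  unfolding label_total_def by (intro sum_mono2) auto

text \<open>Ordinary nodes take exactly one label; each supernode shifts the total by
  \<open>\<bar>s - 1\<bar> \<le> s + 1\<close>.\<close>

lemma label_total_deviation:
  "\<bar>real (label_total s t) - real t\<bar> \<le> (real s + 1) * real (card (super_visits t))"
proof (induction t)
  case 0
  show ?case by (simp add: label_total_def)
next
  case (Suc t)
  have "super_visits (Suc t) = (if is_supernode (visit lam k t) then insert t (super_visits t) else super_visits t)"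
    by (auto simp: super_visits_def less_Suc_eq)
  moreover have "finite (super_visits t)" "t \<notin> super_visits t" by (auto simp: super_visits_def)
  ultimately show ?case using Suc
    by (auto simp: label_total_Suc label_count_def algebra_simps abs_le_iff)
qed

text \<open>The hypotheses make \<open>t\<close> the first time with
  \<open>n \<le> label_total s t\<close>. A leaf visited at time \<open>r\<close> has the single
  label \<open>label_total s r + 1\<close>, which is at most \<open>n\<close> exactly when
  \<open>r < t\<close>.\<close>

lemma leaf_count_eq:
  assumes "n \<le> label_total s t" "\<And>r. r < t \<Longrightarrow> label_total s r < n"
  shows "leaf_count lam k s n = card (leaf_visits t)"
proof -
  have iff: "label_total s r < n \<longleftrightarrow> r < t" for r
    using assms label_total_mono[of t r s] by (meson le_trans not_le)
  have "{v \<in> skel_leaves lam k. \<exists>l\<in>labels lam k s v. l \<le> n} = visit lam k ` leaf_visits t"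
  proof (intro equalityI subsetI)
    fix v assume "v \<in> {v \<in> skel_leaves lam k. \<exists>l\<in>labels lam k s v. l \<le> n}"
    then obtain l where l: "v \<in> skel_leaves lam k" "l \<in> labels lam k s v" "l \<le> n" by blast
    then obtain r where r: "v = visit lam k r" unfolding labels_def by auto
    have "label_total s r < n" using l unfolding r labels_visit by auto
    thus "v \<in> visit lam k ` leaf_visits t" using l(1) r iff by (auto simp: leaf_visits_def)
  next
    fix v assume "v \<in> visit lam k ` leaf_visits t"
    then obtain r where r: "v = visit lam k r" "r < t" "v \<in> skel_leaves lam k"
      by (auto simp: leaf_visits_def)
    hence "label_total s r + 1 \<in> labels lam k s v" "label_total s r + 1 \<le> n"
      using iff[of r] label_count_leaf[of v s] by (auto simp: labels_visit)
    thus "v \<in> {v \<in> skel_leaves lam k. \<exists>l\<in>labels lam k s v. l \<le> n}" using r by blast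
  qed
  thus ?thesis
    unfolding leaf_count_def using card_image[OF inj_on_subset[OF inj_visit]] by simp
qed

lemma leaf_count_tendsto:
  fixes y :: real
  assumes y: "0 < y" "y < 1" and root: "(\<Sum>i=1..k. real (lam i) * y ^ i) = 1"
  shows "(\<lambda>n. real (leaf_count lam k s n) / real n) \<longlonglongrightarrow> 1 - y"
proof (rule affine_bound_imp_tendsto)
  fix \<epsilon> :: real assume "\<epsilon> > 0"
  \<comment> \<open>The bound \<open>1 / 2\<close> allows \<open>t\<close> to be estimated by
    \<open>2 * n\<close> up to a constant; \<open>\<epsilon> / 4\<close> then makes the final error
    \<open>2 * \<eta> * (2 * n)\<close> at most \<open>\<epsilon> * n\<close>.\<close>
  define \<eta> where "\<eta> = min (1 / 2) (\<epsilon> / 4)"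
  have eta: "\<eta> > 0" "\<eta> \<le> 1 / 2" "4 * \<eta> \<le> \<epsilon>" using \<open>\<epsilon> > 0\<close> by (auto simp: \<eta>_def)
  obtain C where C: "C \<ge> 0"
    "\<And>t. \<bar>real (card (leaf_visits t)) - (1 - y) * real t\<bar> \<le> \<eta> * real t + C"
    using leaf_visits_density[OF y root eta(1)] by blast
  obtain C' where C': "C' \<ge> 0" "\<And>t. real (card (super_visits t)) \<le> \<eta> / (real s + 1) * real t + C'"
    using super_visits_density[OF y root, of "\<eta> / (real s + 1)"] eta(1) by auto
  define D where "D = (real s + 1) * C'"
  have D0: "D \<ge> 0" unfolding D_def using C'(1) by simp
  have D: "\<bar>real (label_total s t) - real t\<bar> \<le> \<eta> * real t + D" for t
  proof -
    have "\<bar>real (label_total s t) - real t\<bar> \<le> (real s + 1) * (\<eta> / (real s + 1) * real t + C')"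
      using label_total_deviation[of s t] C'(2)[of t]
      by (meson mult_left_mono order_trans add_nonneg_nonneg of_nat_0_le_iff zero_le_one)
    also have "\<dots> = \<eta> * real t + D" unfolding D_def by (simp add: field_simps)
    finally show ?thesis .
  qed
  have half: "\<eta> * real t \<le> real t / 2" for t using mult_right_mono[OF eta(2), of "real t"] by simp
  \<comment> \<open>\<open>D\<close> comes from the supernodes, \<open>s + 1\<close> from the
    overshoot of \<open>label_total s t\<close> beyond \<open>n\<close>.\<close>
  define F where "F = D + real s + 1"
  have "\<bar>real (leaf_count lam k s n) - (1 - y) * real n\<bar> \<le> \<epsilon> * real n + (C + 3 * F)" for n
  proof -
    \<comment> \<open>The label total at \<open>N\<close> is at least \<open>N / 2 - D\<close>, so
      this \<open>N\<close> reaches \<open>n\<close> even for \<open>s = 0\<close>.\<close>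
    obtain N where N: "real N \<ge> 2 * (real n + D)" using real_arch_simple by blast
    have "real N - real (label_total s N) \<le> real N / 2 + D" using abs_le_D2[OF D[of N]] half[of N] by simp
    hence "real n \<le> real (label_total s N)" using N by (simp add: field_simps)
    hence ex: "n \<le> label_total s N" by simp
    define t where "t = (LEAST t. n \<le> label_total s t)"
    have t: "n \<le> label_total s t" unfolding t_def by (rule LeastI[of _ N]) (rule ex)
    have less: "label_total s r < n" if "r < t" for r
      using not_less_Least that unfolding t_def by fastforce
    have upper: "label_total s t \<le> n + s + 1"
    proof (cases t)
      case 0
      thus ?thesis by (simp add: label_total_def)
    next
      case (Suc r)
      thus ?thesis using less[of r] by (simp add: label_total_Suc label_count_def)
    qed
    have tn: "\<bar>real t - real n\<bar> \<le> \<eta> * real t + F"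
    proof -
      have "real n \<le> real (label_total s t)" "real (label_total s t) \<le> real (n + s + 1)"
        using t upper by (simp_all only: of_nat_le_iff)
      thus ?thesis using D[of t] unfolding F_def by simp
    qed
    hence t_le: "real t \<le> 2 * real n + 2 * F" using half[of t] by linarith
    have "\<bar>(1 - y) * (real t - real n)\<bar> \<le> 1 * \<bar>real t - real n\<bar>"
      unfolding abs_mult using y by (intro mult_right_mono) auto
    hence "\<bar>(1 - y) * real t - (1 - y) * real n\<bar> \<le> \<eta> * real t + F"
      using tn by (simp add: right_diff_distrib)
    hence "\<bar>real (leaf_count lam k s n) - (1 - y) * real n\<bar> \<le> 2 * (\<eta> * real t) + C + F"
      using C(2)[of t] leaf_count_eq[OF t less] by linarith
    also have "\<eta> * real t \<le> \<eta> * (2 * real n + 2 * F)" using t_le eta by (intro mult_left_mono) auto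
    also have "2 * (\<eta> * (2 * real n + 2 * F)) + C + F \<le> \<epsilon> * real n + (C + 3 * F)"
    proof -
      have "4 * \<eta> * real n \<le> \<epsilon> * real n" using eta by (intro mult_right_mono) auto
      moreover have "\<eta> * F \<le> 1 / 2 * F" using eta D0 by (intro mult_right_mono) (auto simp: F_def)
      ultimately show ?thesis by (simp add: algebra_simps)
    qed
    finally show ?thesis by simp
  qed
  thus "\<exists>C. \<forall>n. \<bar>real (leaf_count lam k s n) - (1 - y) * real n\<bar> \<le> \<epsilon> * real n + C" by blast
qed

section \<open>Existence, uniqueness and dominance of the root\<close>

lemma inverse_root_exists: "\<exists>y::real. 0 < y \<and> y < 1 \<and> (\<Sum>i=1..k. real (lam i) * y ^ i) = 1"
proof -
  let ?g = "\<lambda>y::real. \<Sum>i=1..k. real (lam i) * y ^ i"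
  have "?g 0 = 0" by (intro sum.neutral) (auto simp: power_0_left)
  moreover have g1: "?g 1 \<ge> 2" using Lam_ge_2 by (simp add: Lam_def flip: of_nat_sum)
  ultimately obtain y where "0 \<le> y" "y \<le> 1" "?g y = 1"
    using IVT'[of ?g 0 1 1] by (force intro!: continuous_intros)
  moreover have "y \<noteq> 0" "y \<noteq> 1" using \<open>?g y = 1\<close> \<open>?g 0 = 0\<close> g1 by auto
  ultimately show ?thesis by (intro exI[of _ y]) auto
qed

lemma real_root_unique:
  fixes x y :: real
  assumes "0 < y" "(\<Sum>i=1..k. real (lam i) * y ^ i) = 1" "x > 0" "poly (rec_poly lam k) x = 0"
  shows "x = inverse y"
proof -
  have "(\<Sum>i=1..k. real (lam i) * inverse x ^ i) = 1"
    using assms poly_rec_poly_eq_0_iff[of x lam k] by simp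
  hence "inverse x = y"
    using weighted_power_sum_strict_mono[of k lam "inverse x" y]
      weighted_power_sum_strict_mono[of k lam y "inverse x"] k1 lam1 assms
    by (cases "inverse x" y rule: linorder_cases) auto
  thus ?thesis by auto
qed

text \<open>If \<open>w = inverse z\<close> had modulus at most \<open>y\<close>, then every
  \<open>Re (w ^ i)\<close> would be at most \<open>y ^ i\<close>. Equality of the weighted sums
  forces \<open>Re w = y\<close> because \<open>lam 1\<close> is positive, and the modulus bound
  then gives \<open>w = y\<close>.\<close>

lemma root_dominates:
  fixes y :: real and z :: complex
  assumes y: "0 < y" "(\<Sum>i=1..k. real (lam i) * y ^ i) = 1"
    and z: "poly (rec_poly lam k) z = 0" "z \<noteq> complex_of_real (inverse y)"
  shows "cmod z < inverse y"
proof (rule ccontr)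
  assume "\<not> cmod z < inverse y"
  hence zy: "cmod z \<ge> inverse y" by simp
  hence z0: "z \<noteq> 0" using y by auto
  define w where "w = inverse z"
  have w: "(\<Sum>i=1..k. of_nat (lam i) * w ^ i) = 1"
    using poly_rec_poly_eq_0_iff[OF z0] z(1) by (simp add: w_def)
  have wy: "cmod w \<le> y" using zy y z0 by (simp add: w_def norm_inverse inverse_le_imp_le)
  have Re_le: "Re (w ^ i) \<le> y ^ i" for i
    using complex_Re_le_cmod[of "w ^ i"] power_mono[OF wy, of i] by (simp add: norm_power)
  have "(\<Sum>i=1..k. real (lam i) * Re (w ^ i)) = Re (\<Sum>i=1..k. of_nat (lam i) * w ^ i)"
    by (simp add: Re_sum)
  also have "\<dots> = (\<Sum>i=1..k. real (lam i) * y ^ i)" unfolding w y by simp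
  finally have eq: "(\<Sum>i=1..k. real (lam i) * Re (w ^ i)) = (\<Sum>i=1..k. real (lam i) * y ^ i)" .
  have "Re w = y"
  proof (rule ccontr)
    assume "Re w \<noteq> y"
    hence "Re w < y" using Re_le[of 1] by simp
    hence "(\<Sum>i=1..k. real (lam i) * Re (w ^ i)) < (\<Sum>i=1..k. real (lam i) * y ^ i)"
      using Re_le k1 lam1
      by (intro sum_strict_mono_ex1 ballI bexI[of _ 1]) (auto intro: mult_left_mono)
    thus False using eq by simp
  qed
  moreover have "Im w = 0"
    using calculation wy y cmod_power2[of w] power_mono[OF wy, of 2] by simp
  ultimately have "w = complex_of_real y" by (simp add: complex_eq_iff)
  thus False using z(2) z0 unfolding w_def by (metis inverse_inverse_eq of_real_inverse)
qed

end

theorem theorem5p5: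
  fixes lam :: "nat \<Rightarrow> nat" and k :: nat
  assumes "k \<ge> 1"
    and "lam 1 \<ge> 1"
    and "lam k \<ge> 1"
    and "\<And>i. i > k \<Longrightarrow> lam i = 0"
    and "k = 1 \<Longrightarrow> lam 1 \<ge> 2"
  shows "\<exists>\<kappa>::real.
      {x::real. x > 1 \<and> poly (rec_poly lam k) x = 0} = {\<kappa>} \<and>
      (\<forall>z::complex. poly (rec_poly lam k) z = 0 \<and> z \<noteq> complex_of_real \<kappa> \<longrightarrow> cmod z < \<kappa>) \<and>
      (\<forall>s::nat. (\<lambda>n. real (leaf_count lam k s n) / real n) \<longlonglongrightarrow> 1 - 1 / \<kappa>)"
proof -
  interpret skeleton lam k by standard (use assms in auto)
  \<comment> \<open>The witness for \<open>\<kappa>\<close> is \<open>inverse y\<close>, so the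
    limit \<open>1 - 1 / \<kappa>\<close> is \<open>1 - y\<close>.\<close>
  obtain y :: real where y: "0 < y" "y < 1" "(\<Sum>i=1..k. real (lam i) * y ^ i) = 1"
    using inverse_root_exists by blast
  have "poly (rec_poly lam k) (inverse y) = 0"
    using poly_rec_poly_eq_0_iff[of "inverse y" lam k] y by simp
  moreover have "inverse y > 1" using y by (simp add: one_less_inverse)
  ultimately have "{x::real. x > 1 \<and> poly (rec_poly lam k) x = 0} = {inverse y}"
    using real_root_unique[OF y(1,3)] by force
  moreover have "\<forall>z::complex. poly (rec_poly lam k) z = 0 \<and> z \<noteq> complex_of_real (inverse y) \<longrightarrow> cmod z < inverse y"
    using root_dominates[OF y(1,3)] by blast
  moreover have "\<forall>s::nat. (\<lambda>n. real (leaf_count lam k s n) / real n) \<longlonglongrightarrow> 1 - 1 / inverse y"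
    using leaf_count_tendsto[OF y] by (simp add: inverse_eq_divide)
  ultimately show ?thesis by blast
qed

end
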